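(* In the setting of the context (finite reversible ergodic Markov process on $\mathcal X$, with a choice of one path $\gamma(x,y)$ for each pair $x\neq y$), let $\eta$ be a probability measure on $\mathcal X$. (i) Let $p\in(0,1)$ and let $\lambda(x)$ and $\mu(x)$ be two positive functions on $\mathcal X$. Then $$\frac1{\mathcal L_\eta(p)}\le 2^{2/p-1}\left(\sum_{x}\pi(x)\lambda(x)^{p/(1-p)}\ \sum_y\eta(y)\mu(y)^{p/(1-p)}\right)^{(2-2p)/p}\left(\sum_{e:\,Q(e)\neq0}\frac1{Q(e)}\Big(\sum_{x,y:\,e\in\gamma(x,y)}\frac{\pi(x)\eta(y)}{\lambda(x)\mu(y)}\Big)^2\right).$$ (ii) $$\frac1{\mathcal L_\eta(1)}\le 2\left(\sum_{e:\,Q(e)\neq0}\frac1{Q(e)}\Big(\sum_{x,y:\,e\in\gamma(x,y)}\pi(x)\eta(y)\Big)^2\right).$$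
   Context: $X=(X_t)_{t\ge0}$ is a homogeneous continuous-time Markov process on a finite set $\mathcal X$ (with at least two points), with jump rates $K(x,y)$, $x\ne y$. It has a unique invariant (ergodic) probability measure $\pi$; $\pi(x)>0$ for all $x$ and $\pi$ is reversible, i.e. $\pi(x)K(x,y)=\pi(y)K(y,x)$; hence $X$ is irreducible. For an (ordered) edge $e=(x,y)$, $x\neq y$, put $Q(e)=\pi(x)K(x,y)$. The Dirichlet form is $\mathcal E(f,f)=\tfrac12\sum_{e=(x,y)}Q(e)(f(x)-f(y))^2$. For a probability measure $\eta$ on $\mathcal X$, $\eta(f)=\sum_x\eta(x)f(x)$, and for $p\in(0,1]$, $$\mathcal L_\eta(p)=\inf\left\{\frac{\mathcal E(f,f)\,\|f\|_\infty^{(2-2p)/p}}{\eta(|f|)^{2/p}}\ :\ f:\mathcal X\to\mathbb R,\ \pi(f)=0,\ \eta(|f|)>0\right\}.$$ A path from $x$ to $y$ is a sequence of vertices $(x_0,\dots,x_k)$ with $x_0=x$, $x_k=y$ and $Q(x_{i-1},x_i)\neq0$ for all $i=1,\dots,k$; it is identified with the sequence of its edges $e_i=(x_{i-1},x_i)$. For each ordered pair $x\neq y$ in $\mathcal X$ one path $\gamma(x,y)$ from $x$ to $y$ is fixed (arbitrarily). *)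

theory Defs
  imports "HOL-Probability.Probability"
begin

text \<open>
  A homogeneous continuous-time Markov process on the finite state space \<^typ>\<open>'a\<close> is given by its
  transition laws: \<open>P t x\<close> is the law of \<open>X\<^sub>t\<close> when the process starts at \<open>x\<close>. The last two conditions
  say that \<open>K\<close> are its jump rates; the values \<open>K x x\<close> are irrelevant throughout.
\<close>

definition markov_process ::
  "(real \<Rightarrow> 'a::finite \<Rightarrow> 'a pmf) \<Rightarrow> ('a \<Rightarrow> 'a \<Rightarrow> real) \<Rightarrow> bool" where
  "markov_process P K \<longleftrightarrow>
     (\<forall>x. P 0 x = return_pmf x) \<and>
     (\<forall>s\<ge>0. \<forall>t\<ge>0. \<forall>x. P (s + t) x = bind_pmf (P s x) (P t)) \<and>
     (\<forall>x y. x \<noteq> y \<longrightarrow> 0 \<le> K x y) \<and>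
     (\<forall>x y. x \<noteq> y \<longrightarrow>
        ((\<lambda>t. pmf (P t x) y) has_real_derivative K x y) (at 0 within {0..}))"

definition invariant_measure :: "(real \<Rightarrow> 'a::finite \<Rightarrow> 'a pmf) \<Rightarrow> 'a pmf \<Rightarrow> bool" where
  "invariant_measure P \<nu> \<longleftrightarrow> (\<forall>t\<ge>0. bind_pmf \<nu> (P t) = \<nu>)"

definition reversible :: "('a::finite \<Rightarrow> 'a \<Rightarrow> real) \<Rightarrow> 'a pmf \<Rightarrow> bool" where
  "reversible K \<pi> \<longleftrightarrow> (\<forall>x y. x \<noteq> y \<longrightarrow> pmf \<pi> x * K x y = pmf \<pi> y * K y x)"

definition mean :: "'a::finite pmf \<Rightarrow> ('a \<Rightarrow> real) \<Rightarrow> real" where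
  "mean \<eta> f = (\<Sum>x\<in>UNIV. pmf \<eta> x * f x)"

definition sup_norm :: "('a::finite \<Rightarrow> real) \<Rightarrow> real" where
  "sup_norm f = Max (range (\<lambda>x. \<bar>f x\<bar>))"

definition edges :: "('a::finite \<times> 'a) set" where
  "edges = {(x, y). x \<noteq> y}"

definition Q :: "'a::finite pmf \<Rightarrow> ('a \<Rightarrow> 'a \<Rightarrow> real) \<Rightarrow> 'a \<times> 'a \<Rightarrow> real" where
  "Q \<pi> K = (\<lambda>(x, y). pmf \<pi> x * K x y)"

definition dirichlet_form :: "'a::finite pmf \<Rightarrow> ('a \<Rightarrow> 'a \<Rightarrow> real) \<Rightarrow> ('a \<Rightarrow> real) \<Rightarrow> real" where
  "dirichlet_form \<pi> K f = 1 / 2 * (\<Sum>(x, y)\<in>edges. Q \<pi> K (x, y) * (f x - f y)\<^sup>2)"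

text \<open>
  Extended-real valued, so that \<open>1 / L_const \<pi> K \<eta> p\<close> would be \<open>\<infinity>\<close> (and not \<open>0\<close>) if the infimum
  were \<open>0\<close>.
\<close>

definition L_const ::
  "'a::finite pmf \<Rightarrow> ('a \<Rightarrow> 'a \<Rightarrow> real) \<Rightarrow> 'a pmf \<Rightarrow> real \<Rightarrow> ereal" where
  "L_const \<pi> K \<eta> p =
     (INF f\<in>{f. mean \<pi> f = 0 \<and> mean \<eta> (\<lambda>x. \<bar>f x\<bar>) > 0}.
        ereal (dirichlet_form \<pi> K f * sup_norm f powr ((2 - 2 * p) / p)
               / mean \<eta> (\<lambda>x. \<bar>f x\<bar>) powr (2 / p)))"

definition path_edges :: "'a list \<Rightarrow> ('a \<times> 'a) list" where
  "path_edges xs = zip xs (tl xs)"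

definition is_path ::
  "'a::finite pmf \<Rightarrow> ('a \<Rightarrow> 'a \<Rightarrow> real) \<Rightarrow> 'a \<Rightarrow> 'a \<Rightarrow> 'a list \<Rightarrow> bool" where
  "is_path \<pi> K x y xs \<longleftrightarrow>
     xs \<noteq> [] \<and> hd xs = x \<and> last xs = y \<and>
     (\<forall>e\<in>set (path_edges xs). e \<in> edges \<and> Q \<pi> K e \<noteq> 0)"

text \<open>The pairs \<open>x \<noteq> y\<close> whose chosen path uses the edge \<open>e\<close>; the values \<open>\<gamma> x x\<close> play no role.\<close>

definition pairs_through ::
  "('a::finite \<Rightarrow> 'a \<Rightarrow> 'a list) \<Rightarrow> 'a \<times> 'a \<Rightarrow> ('a \<times> 'a) set" where
  "pairs_through \<gamma> e = {(x, y). x \<noteq> y \<and> e \<in> set (path_edges (\<gamma> x y))}"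

end

theory Submission
  imports Defs
begin

text \<open>
  Since \<open>\<pi>(f) = 0\<close>, one has \<open>\<eta>(|f|) \<le> \<Sum> \<pi>(x) \<eta>(y) |f(x) - f(y)|\<close>. Writing \<open>f(x) - f(y)\<close> as a sum of
  increments along \<open>\<gamma>(x,y)\<close>, exchanging the summations and applying the Cauchy-Schwarz inequality over
  the edges gives (ii). For (i), Hoelder's inequality with exponents \<open>1/(1-p)\<close> and \<open>1/p\<close> first splits
  \<open>|f(x) - f(y)|\<close> into a factor bounded by means of \<open>|f(x) - f(y)| \<le> 2 \<parallel>f\<parallel>\<close> and a factor
  \<open>|f(x) - f(y)| / (\<lambda>(x) \<mu>(y))\<close>, to which the argument of (ii) applies.
\<close>

section \<open>Hoelder's inequality for finite sums, via Young's inequality\<close>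

lemma Holder_powr_sum:
  fixes a b :: "'i \<Rightarrow> real"
  assumes "finite I" "0 < p" "p < 1" "\<And>i. i \<in> I \<Longrightarrow> 0 \<le> a i" "\<And>i. i \<in> I \<Longrightarrow> 0 \<le> b i"
  shows "(\<Sum>i\<in>I. a i powr (1 - p) * b i powr p) \<le> (\<Sum>i\<in>I. a i) powr (1 - p) * (\<Sum>i\<in>I. b i) powr p"
proof (cases "sum a I = 0 \<or> sum b I = 0")
  \<comment> \<open>A vanishing sum cannot be normalised; here each term on the left has a factor
    \<open>0 powr _\<close>, which is 0.\<close>
  case True
  then have "(\<forall>i\<in>I. a i = 0) \<or> (\<forall>i\<in>I. b i = 0)"
    using assms sum_nonneg_eq_0_iff by blast
  then have "(\<Sum>i\<in>I. a i powr (1 - p) * b i powr p) = 0"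
    by (auto intro!: sum.neutral)
  then show ?thesis
    by simp
next
  case False
  define A B where "A = sum a I" and "B = sum b I"
  have pos: "0 < A" "0 < B"
    using False assms sum_nonneg[of I a] sum_nonneg[of I b] by (auto simp: A_def B_def)
  \<comment> \<open>After division by \<open>A\<close> and \<open>B\<close> each family sums to 1,
    so summing Young's bound over \<open>i\<close> gives (1 - p) + p = 1.\<close>
  have young: "(a i / A) powr (1 - p) * (b i / B) powr p \<le> (1 - p) * (a i / A) + p * (b i / B)"
    if "i \<in> I" for i
  proof (cases "a i = 0 \<or> b i = 0")
    case True
    then show ?thesis
      using assms that pos by auto
  next
    case False
    then have "0 < a i" "0 < b i"
      using assms that by (simp_all add: less_le)
    then show ?thesis
      using assms pos by (intro Youngs_inequality_0) auto
  qed
  have "(\<Sum>i\<in>I. a i powr (1 - p) * b i powr p)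
      = A powr (1 - p) * B powr p * (\<Sum>i\<in>I. (a i / A) powr (1 - p) * (b i / B) powr p)"
    unfolding sum_distrib_left using assms pos by (intro sum.cong) (auto simp: powr_divide)
  also have "\<dots> \<le> A powr (1 - p) * B powr p * (\<Sum>i\<in>I. (1 - p) * (a i / A) + p * (b i / B))"
    using young by (intro mult_left_mono sum_mono) auto
  also have "(\<Sum>i\<in>I. (1 - p) * (a i / A) + p * (b i / B)) = (1 - p) * (A / A) + p * (B / B)"
    by (simp add: sum.distrib A_def B_def flip: sum_distrib_left sum_divide_distrib)
  also have "\<dots> = 1"
    using pos by simp
  finally show ?thesis
    by (simp add: A_def B_def)
qed

section \<open>Increments of a function along a path\<close>

lemma path_edges_Cons_Cons [simp]: "path_edges (x # y # xs) = (x, y) # path_edges (y # xs)"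
  by (simp add: path_edges_def)

lemma path_edges_append_subset: "set (path_edges ys) \<subseteq> set (path_edges (xs @ ys))"
proof (induction xs)
  case (Cons x xs)
  then show ?case
    by (cases "xs @ ys") (auto simp: path_edges_def)
qed simp

lemma fst_path_edges: "e \<in> set (path_edges xs) \<Longrightarrow> fst e \<in> set xs"
  by (cases e) (auto simp: path_edges_def dest: set_zip_leftD)

text \<open>
  An edge repeated by the path is counted only once on the right-hand side; loops are therefore cut out
  in the induction.
\<close>

lemma abs_diff_le_sum_path_edges:
  fixes f :: "'a \<Rightarrow> real"
  assumes "xs \<noteq> []"
  shows "\<bar>f (hd xs) - f (last xs)\<bar> \<le> (\<Sum>e\<in>set (path_edges xs). \<bar>f (fst e) - f (snd e)\<bar>)"
  using assms
proof (induction "length xs" arbitrary: xs rule: less_induct)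
  case less
  let ?S = "\<lambda>xs. \<Sum>e\<in>set (path_edges xs). \<bar>f (fst e) - f (snd e)\<bar>"
  obtain x ys where xs: "xs = x # ys"
    using less.prems by (cases xs) auto
  show ?case
  proof (cases "x \<in> set ys")
    \<comment> \<open>The path returns to its start: the suffix beginning at the later visit is
      shorter, has the same endpoints and uses only edges of the original path.\<close>
    case True
    then obtain us vs where ys: "ys = us @ x # vs"
      by (meson split_list)
    have "\<bar>f (hd (x # vs)) - f (last (x # vs))\<bar> \<le> ?S (x # vs)"
      by (rule less.hyps) (auto simp: xs ys)
    also have "\<dots> \<le> ?S xs"
      using path_edges_append_subset[of "x # vs" "x # us"] by (intro sum_mono2) (auto simp: xs ys)
    finally show ?thesis
      by (simp add: xs ys)
  next
    case False
    show ?thesis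
    proof (cases ys)
      case Nil
      then show ?thesis
        by (simp add: xs path_edges_def)
    next
      case (Cons y zs)
      \<comment> \<open>No later edge starts at \<open>x\<close>, so the first edge adds its own
        term to a sum over the set of edges.\<close>
      have "(x, y) \<notin> set (path_edges ys)"
        using False fst_path_edges by fastforce
      then have "?S xs = \<bar>f x - f y\<bar> + ?S ys"
        by (simp add: xs Cons)
      moreover have "\<bar>f (hd ys) - f (last ys)\<bar> \<le> ?S ys"
        by (rule less.hyps) (auto simp: xs Cons)
      ultimately show ?thesis
        by (simp add: xs Cons)
    qed
  qed
qed

section \<open>Mean, differences over pairs, and the Dirichlet form\<close>

lemma abs_le_sup_norm: "\<bar>f x\<bar> \<le> sup_norm f"
  by (auto simp: sup_norm_def intro!: Max_ge)

lemma sup_norm_nonneg: "0 \<le> sup_norm f"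
  using abs_le_sup_norm[of f undefined] by linarith

lemma sum_prod_UNIV:
  fixes g :: "'a::finite \<times> 'a \<Rightarrow> real"
  shows "(\<Sum>z\<in>UNIV. g z) = (\<Sum>x\<in>UNIV. \<Sum>y\<in>UNIV. g (x, y))"
  by (simp add: sum.cartesian_product)

text \<open>Centring makes \<open>- f y\<close> the \<pi>-average of \<open>f x - f y\<close>; the
  triangle inequality, averaged over \<open>y\<close> with weights \<eta>, does the rest.\<close>

lemma mean_abs_le_sum_diff:
  fixes \<pi> \<eta> :: "'a::finite pmf"
  assumes "mean \<pi> f = 0"
  shows "mean \<eta> (\<lambda>x. \<bar>f x\<bar>) \<le> (\<Sum>(x, y)\<in>UNIV. pmf \<pi> x * pmf \<eta> y * \<bar>f x - f y\<bar>)"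
proof -
  have *: "\<bar>f y\<bar> \<le> (\<Sum>x\<in>UNIV. pmf \<pi> x * \<bar>f x - f y\<bar>)" for y
  proof -
    have "(\<Sum>x\<in>UNIV. pmf \<pi> x * (f x - f y)) = - f y"
      using assms by (simp add: mean_def right_diff_distrib sum_subtractf sum_pmf_eq_1
          flip: sum_distrib_right)
    then have "\<bar>f y\<bar> = \<bar>\<Sum>x\<in>UNIV. pmf \<pi> x * (f x - f y)\<bar>"
      by simp
    also have "\<dots> \<le> (\<Sum>x\<in>UNIV. \<bar>pmf \<pi> x * (f x - f y)\<bar>)"
      by (rule sum_abs)
    finally show ?thesis
      by (simp add: abs_mult)
  qed
  have "mean \<eta> (\<lambda>x. \<bar>f x\<bar>) \<le> (\<Sum>y\<in>UNIV. pmf \<eta> y * (\<Sum>x\<in>UNIV. pmf \<pi> x * \<bar>f x - f y\<bar>))"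
    unfolding mean_def using * by (intro sum_mono mult_left_mono) auto
  also have "\<dots> = (\<Sum>x\<in>UNIV. \<Sum>y\<in>UNIV. pmf \<pi> x * pmf \<eta> y * \<bar>f x - f y\<bar>)"
    unfolding sum_distrib_left by (subst sum.swap) (simp add: mult_ac)
  finally show ?thesis
    by (simp add: sum_prod_UNIV)
qed

text \<open>The weight \<open>w\<close> is left general to serve both parts: \<pi>(x) \<eta>(y) in
  (ii), and the same divided by \<open>lam x * \<mu> y\<close> in (i).\<close>

lemma sum_diff_path_bound:
  fixes \<pi> :: "'a::finite pmf" and w :: "'a \<times> 'a \<Rightarrow> real"
  assumes K: "\<And>x y. x \<noteq> y \<Longrightarrow> 0 \<le> K x y"
    and path: "\<And>x y. x \<noteq> y \<Longrightarrow> is_path \<pi> K x y (\<gamma> x y)"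
    and w: "\<And>z. 0 \<le> w z"
  shows "(\<Sum>(x, y)\<in>UNIV. w (x, y) * \<bar>f x - f y\<bar>)\<^sup>2
       \<le> 2 * dirichlet_form \<pi> K f
          * (\<Sum>e\<in>{e \<in> edges. Q \<pi> K e \<noteq> 0}. 1 / Q \<pi> K e * (\<Sum>z\<in>pairs_through \<gamma> e. w z)\<^sup>2)"
proof -
  define E where "E = {e \<in> edges. Q \<pi> K e \<noteq> 0}"
  define d where "d = (\<lambda>e::'a \<times> 'a. \<bar>f (fst e) - f (snd e)\<bar>)"
  define A where "A e = (\<Sum>z\<in>pairs_through \<gamma> e. w z)" for e
  have Qpos: "0 < Q \<pi> K e" if "e \<in> E" for e
    using that K by (auto simp: E_def Q_def edges_def less_le)
  have "(\<Sum>(x, y)\<in>UNIV. w (x, y) * \<bar>f x - f y\<bar>) = (\<Sum>z\<in>UNIV. w z * d z)"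
    by (simp add: d_def case_prod_beta)
  \<comment> \<open>Here \<open>edges\<close> serves as the set of all off-diagonal pairs, whatever
    their rates; \<open>d\<close> vanishes on the diagonal.\<close>
  also have "\<dots> = (\<Sum>z\<in>edges. w z * d z)"
    by (rule sum.mono_neutral_right) (auto simp: edges_def d_def)
  also have "\<dots> \<le> (\<Sum>z\<in>edges. \<Sum>e\<in>{e \<in> E. z \<in> pairs_through \<gamma> e}. w z * d e)"
  proof (rule sum_mono)
    fix z :: "'a \<times> 'a" assume z: "z \<in> edges"
    obtain x y where xy: "z = (x, y)" "x \<noteq> y"
      using z by (auto simp: edges_def)
    note p = path[OF xy(2), unfolded is_path_def]
    have "{e \<in> E. z \<in> pairs_through \<gamma> e} = set (path_edges (\<gamma> x y))"
      using p xy by (auto simp: E_def pairs_through_def)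
    moreover have "d z \<le> (\<Sum>e\<in>set (path_edges (\<gamma> x y)). d e)"
      using abs_diff_le_sum_path_edges[of "\<gamma> x y" f] p by (simp add: d_def xy)
    ultimately show "w z * d z \<le> (\<Sum>e\<in>{e \<in> E. z \<in> pairs_through \<gamma> e}. w z * d e)"
      using w by (simp add: mult_left_mono flip: sum_distrib_left)
  qed
  also have "\<dots> = (\<Sum>e\<in>E. \<Sum>z\<in>{z \<in> edges. z \<in> pairs_through \<gamma> e}. w z * d e)"
    by (rule sum.swap_restrict) simp_all
  also have "\<dots> = (\<Sum>e\<in>E. A e * d e)"
    unfolding A_def sum_distrib_right
    by (intro sum.cong) (auto simp: pairs_through_def edges_def)
  \<comment> \<open>The square root of \<open>Q\<close> is inserted so that, after Cauchy-Schwarz,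
    the first factor is twice the Dirichlet form and the second carries 1/Q.\<close>
  also have "\<dots> = (\<Sum>e\<in>E. (sqrt (Q \<pi> K e) * d e) * (A e / sqrt (Q \<pi> K e)))"
    using Qpos by (intro sum.cong) (fastforce simp: less_le)+
  finally have le: "(\<Sum>(x, y)\<in>UNIV. w (x, y) * \<bar>f x - f y\<bar>) \<le> \<dots>" .
  have "(\<Sum>(x, y)\<in>UNIV. w (x, y) * \<bar>f x - f y\<bar>)\<^sup>2
      \<le> (\<Sum>e\<in>E. (sqrt (Q \<pi> K e) * d e) * (A e / sqrt (Q \<pi> K e)))\<^sup>2"
    using w by (intro power_mono[OF le]) (auto intro!: sum_nonneg)
  also have "\<dots> \<le> (\<Sum>e\<in>E. (sqrt (Q \<pi> K e) * d e)\<^sup>2) * (\<Sum>e\<in>E. (A e / sqrt (Q \<pi> K e))\<^sup>2)"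
    by (rule Cauchy_Schwarz_ineq_sum)
  also have "(\<Sum>e\<in>E. (sqrt (Q \<pi> K e) * d e)\<^sup>2) = (\<Sum>e\<in>E. Q \<pi> K e * (f (fst e) - f (snd e))\<^sup>2)"
    using Qpos by (intro sum.cong) (auto simp: d_def power_mult_distrib less_imp_le)
  also have "\<dots> = (\<Sum>e\<in>edges. Q \<pi> K e * (f (fst e) - f (snd e))\<^sup>2)"
    by (rule sum.mono_neutral_left) (auto simp: E_def)
  also have "\<dots> = 2 * dirichlet_form \<pi> K f"
    by (simp add: dirichlet_form_def case_prod_beta)
  also have "(\<Sum>e\<in>E. (A e / sqrt (Q \<pi> K e))\<^sup>2) = (\<Sum>e\<in>E. 1 / Q \<pi> K e * (A e)\<^sup>2)"
    using Qpos by (intro sum.cong) (auto simp: power_divide less_imp_le)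
  finally show ?thesis
    by (simp add: E_def A_def)
qed

section \<open>From inequalities for single functions to the reciprocal of the infimum\<close>

lemma inverse_INF_ereal_le:
  fixes v :: "'b \<Rightarrow> real"
  assumes "0 \<le> C" and le: "\<And>f. f \<in> S \<Longrightarrow> 1 \<le> C * v f"
  shows "1 / (INF f\<in>S. ereal (v f)) \<le> ereal C"
proof (cases "S = {}")
  \<comment> \<open>The infimum over the empty set is infinite, and its reciprocal is 0.\<close>
  case True
  then show ?thesis
    using assms by (simp add: top_ereal_def)
next
  case False
  then have C: "0 < C"
    using assms by (metis ex_in_conv less_le mult_zero_left not_one_le_zero)
  \<comment> \<open>Being bounded below by \<open>1 / C > 0\<close>, the infimum lies in the range
    where inversion reverses the order.\<close>
  have "ereal (1 / C) \<le> (INF f\<in>S. ereal (v f))"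
    using le C by (intro INF_greatest) (simp add: field_simps)
  then have "inverse (INF f\<in>S. ereal (v f)) \<le> inverse (ereal (1 / C))"
    using C by (intro ereal_inverse_antimono) auto
  then show ?thesis
    using C by (simp add: divide_ereal_def)
qed

text \<open>Clears the denominator, which is positive for every admissible \<open>f\<close>.\<close>

lemma inverse_L_const_le:
  assumes "0 \<le> C"
    and "\<And>f. mean \<pi> f = 0 \<Longrightarrow> 0 < mean \<eta> (\<lambda>x. \<bar>f x\<bar>) \<Longrightarrow>
           mean \<eta> (\<lambda>x. \<bar>f x\<bar>) powr (2 / p)
             \<le> C * (dirichlet_form \<pi> K f * sup_norm f powr ((2 - 2 * p) / p))"
  shows "1 / L_const \<pi> K \<eta> p \<le> ereal C"
  unfolding L_const_def using assms by (intro inverse_INF_ereal_le) (auto simp: le_divide_eq)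

section \<open>The Hoelder step for \<open>p < 1\<close>\<close>

lemma weighted_diff_sum_le:
  fixes \<pi> \<eta> :: "'a::finite pmf"
  assumes p: "0 < p" "p < 1" and pos: "\<And>x. 0 < lam x" "\<And>x. 0 < \<mu> x"
  shows "(\<Sum>(x, y)\<in>UNIV. pmf \<pi> x * pmf \<eta> y * \<bar>f x - f y\<bar>)
    \<le> (2 * sup_norm f * ((\<Sum>x\<in>UNIV. pmf \<pi> x * lam x powr (p / (1 - p)))
                        * (\<Sum>y\<in>UNIV. pmf \<eta> y * \<mu> y powr (p / (1 - p))))) powr (1 - p)
      * (\<Sum>(x, y)\<in>UNIV. pmf \<pi> x * pmf \<eta> y / (lam x * \<mu> y) * \<bar>f x - f y\<bar>) powr p"
    (is "_ \<le> (2 * _ * ?M) powr _ * ?T powr p")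
proof -
  define a where "a = (\<lambda>(x, y). pmf \<pi> x * pmf \<eta> y * (lam x * \<mu> y) powr (p / (1 - p)) * \<bar>f x - f y\<bar>)"
  define b where "b = (\<lambda>(x, y). pmf \<pi> x * pmf \<eta> y / (lam x * \<mu> y) * \<bar>f x - f y\<bar>)"
  \<comment> \<open>The exponent p/(1-p) is chosen for this: its (1-p)-th power leaves (lam
    \<mu>)^p, which cancels the denominator of \<open>b powr p\<close>.\<close>
  have ab: "pmf \<pi> x * pmf \<eta> y * \<bar>f x - f y\<bar> = a (x, y) powr (1 - p) * b (x, y) powr p" for x y
  proof -
    define u where "u = pmf \<pi> x * pmf \<eta> y * \<bar>f x - f y\<bar>"
    define l where "l = lam x * \<mu> y"
    have u: "0 \<le> u" and l: "0 < l"
      using pos by (simp_all add: u_def l_def)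
    have "a (x, y) powr (1 - p) * b (x, y) powr p
        = (u * l powr (p / (1 - p))) powr (1 - p) * (u / l) powr p"
      by (simp add: a_def b_def u_def l_def mult_ac)
    also have "\<dots> = (u powr (1 - p) * u powr p) * (l powr p / l powr p)"
      using u l p by (simp add: powr_mult powr_divide powr_powr)
    also have "\<dots> = u"
      using u l by (simp flip: powr_add)
    finally show ?thesis
      by (simp add: u_def)
  qed
  have nonneg: "0 \<le> a z" "0 \<le> b z" for z
    using pos by (auto simp: a_def b_def less_imp_le split: prod.split)
  have "(\<Sum>(x, y)\<in>UNIV. pmf \<pi> x * pmf \<eta> y * \<bar>f x - f y\<bar>)
      = (\<Sum>z\<in>UNIV. a z powr (1 - p) * b z powr p)"
    using ab by (intro sum.cong) auto
  also have "\<dots> \<le> sum a UNIV powr (1 - p) * sum b UNIV powr p"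
    using p nonneg by (intro Holder_powr_sum) auto
  also have "\<dots> \<le> (2 * sup_norm f * ?M) powr (1 - p) * sum b UNIV powr p"
  proof (intro mult_right_mono powr_mono2)
    have diff: "\<bar>f x - f y\<bar> \<le> 2 * sup_norm f" for x y
      using abs_le_sup_norm[of f x] abs_le_sup_norm[of f y] by linarith
    have "sum a UNIV \<le> (\<Sum>(x, y)\<in>UNIV.
        pmf \<pi> x * pmf \<eta> y * (lam x * \<mu> y) powr (p / (1 - p)) * (2 * sup_norm f))"
      unfolding a_def using diff by (intro sum_mono) (auto intro!: mult_left_mono)
    \<comment> \<open>With the differences replaced by a constant, the double sum factorises into
      one sum over \<open>x\<close> and one over \<open>y\<close>.\<close>
    also have "\<dots> = 2 * sup_norm f * ?M"
      using pos unfolding sum_prod_UNIV sum_product unfolding sum_distrib_left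
      by (intro sum.cong) (auto simp: powr_mult less_imp_le mult_ac)
    finally show "sum a UNIV \<le> 2 * sup_norm f * ?M" .
  qed (use p nonneg in \<open>auto intro: sum_nonneg\<close>)
  finally show ?thesis
    by (simp add: b_def)
qed

section \<open>Assembly of the bounds for \<open>p < 1\<close> and \<open>p = 1\<close>\<close>

theorem theorem2p2:
  fixes P :: "real \<Rightarrow> 'a::finite \<Rightarrow> 'a pmf"
    and K :: "'a \<Rightarrow> 'a \<Rightarrow> real"
    and \<pi> \<eta> :: "'a pmf"
    and \<gamma> :: "'a \<Rightarrow> 'a \<Rightarrow> 'a list"
  assumes "CARD('a) \<ge> 2"
    and "markov_process P K"
    and "invariant_measure P \<pi>"
    and "\<And>\<nu>. invariant_measure P \<nu> \<Longrightarrow> \<nu> = \<pi>"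
    and "\<And>x. pmf \<pi> x > 0"
    and "reversible K \<pi>"
    and "\<And>x y. x \<noteq> y \<Longrightarrow> is_path \<pi> K x y (\<gamma> x y)"
  shows "(\<forall>(p::real) (lam :: 'a \<Rightarrow> real) (\<mu> :: 'a \<Rightarrow> real).
            0 < p \<and> p < 1 \<and> (\<forall>x. lam x > 0) \<and> (\<forall>x. \<mu> x > 0) \<longrightarrow>
            1 / L_const \<pi> K \<eta> p \<le> ereal
              (2 powr (2 / p - 1)
               * ((\<Sum>x\<in>UNIV. pmf \<pi> x * lam x powr (p / (1 - p)))
                  * (\<Sum>y\<in>UNIV. pmf \<eta> y * \<mu> y powr (p / (1 - p)))) powr ((2 - 2 * p) / p)
               * (\<Sum>e\<in>{e \<in> edges. Q \<pi> K e \<noteq> 0}. 1 / Q \<pi> K e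
                    * (\<Sum>(x, y)\<in>pairs_through \<gamma> e. pmf \<pi> x * pmf \<eta> y / (lam x * \<mu> y))\<^sup>2)))
       \<and> 1 / L_const \<pi> K \<eta> 1 \<le> ereal
              (2 * (\<Sum>e\<in>{e \<in> edges. Q \<pi> K e \<noteq> 0}. 1 / Q \<pi> K e
                     * (\<Sum>(x, y)\<in>pairs_through \<gamma> e. pmf \<pi> x * pmf \<eta> y)\<^sup>2))"
proof -
  have K: "\<And>x y. x \<noteq> y \<Longrightarrow> 0 \<le> K x y"
    using assms(2) by (auto simp: markov_process_def)
  have S: "0 \<le> (\<Sum>e\<in>{e \<in> edges. Q \<pi> K e \<noteq> 0}. 1 / Q \<pi> K e * (g e)\<^sup>2)" for g
    using K by (auto intro!: sum_nonneg simp: Q_def edges_def)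
  show ?thesis
  proof (intro conjI allI impI)
    fix p :: real and lam \<mu> :: "'a \<Rightarrow> real"
    assume "0 < p \<and> p < 1 \<and> (\<forall>x. lam x > 0) \<and> (\<forall>x. \<mu> x > 0)"
    then have p: "0 < p" "p < 1" and pos: "\<And>x. 0 < lam x" "\<And>x. 0 < \<mu> x"
      by auto
    define w where "w = (\<lambda>(x, y). pmf \<pi> x * pmf \<eta> y / (lam x * \<mu> y))"
    define B where "B = (\<Sum>e\<in>{e \<in> edges. Q \<pi> K e \<noteq> 0}. 1 / Q \<pi> K e * (\<Sum>z\<in>pairs_through \<gamma> e. w z)\<^sup>2)"
    define M where "M = (\<Sum>x\<in>UNIV. pmf \<pi> x * lam x powr (p / (1 - p)))
                    * (\<Sum>y\<in>UNIV. pmf \<eta> y * \<mu> y powr (p / (1 - p)))"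
    have w: "0 \<le> w z" for z
      using pos by (auto simp: w_def less_imp_le split: prod.split)
    have B: "0 \<le> B" and M: "0 \<le> M"
      using S by (auto simp: B_def M_def intro!: mult_nonneg_nonneg sum_nonneg)
    have "1 / L_const \<pi> K \<eta> p \<le> ereal (2 powr (2 / p - 1) * M powr ((2 - 2 * p) / p) * B)"
    proof (rule inverse_L_const_le)
      fix f assume f: "mean \<pi> f = 0" "0 < mean \<eta> (\<lambda>x. \<bar>f x\<bar>)"
      define T where "T = (\<Sum>(x, y)\<in>UNIV. w (x, y) * \<bar>f x - f y\<bar>)"
      have T: "0 \<le> T" "T\<^sup>2 \<le> 2 * dirichlet_form \<pi> K f * B"
        using w sum_diff_path_bound[OF K assms(7) w] by (auto simp: T_def B_def intro!: sum_nonneg)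
      have "mean \<eta> (\<lambda>x. \<bar>f x\<bar>) \<le> (2 * sup_norm f * M) powr (1 - p) * T powr p"
        using order_trans[OF mean_abs_le_sum_diff[OF f(1)] weighted_diff_sum_le[OF p pos]]
        by (simp add: T_def w_def M_def)
      \<comment> \<open>The power 2/p turns \<open>T powr p\<close> into the square of
        \<open>T\<close>, which the path bound controls.\<close>
      then have "mean \<eta> (\<lambda>x. \<bar>f x\<bar>) powr (2 / p)
          \<le> ((2 * sup_norm f * M) powr (1 - p) * T powr p) powr (2 / p)"
        using f p by (intro powr_mono2) auto
      also have "\<dots> = (2 * sup_norm f * M) powr ((2 - 2 * p) / p) * T\<^sup>2"
        using p T by (simp add: powr_mult powr_powr algebra_simps)
      also have "\<dots> \<le> (2 * sup_norm f * M) powr ((2 - 2 * p) / p) * (2 * dirichlet_form \<pi> K f * B)"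
        using T by (intro mult_left_mono) auto
      also have "\<dots> = (2 powr ((2 - 2 * p) / p) * 2) * M powr ((2 - 2 * p) / p) * B
          * (dirichlet_form \<pi> K f * sup_norm f powr ((2 - 2 * p) / p))"
        using M sup_norm_nonneg[of f] by (simp add: powr_mult)
      \<comment> \<open>One power of 2 stems from bounding differences by
        \<open>2 * sup_norm f\<close>, the other factor 2 from the one half in the Dirichlet
        form.\<close>
      also have "2 powr ((2 - 2 * p) / p) * 2 = 2 powr ((2 - 2 * p) / p + 1)"
        by (simp add: powr_add)
      also have "(2 - 2 * p) / p + 1 = 2 / p - 1"
        using p by (simp add: field_simps)
      finally show "mean \<eta> (\<lambda>x. \<bar>f x\<bar>) powr (2 / p)
          \<le> 2 powr (2 / p - 1) * M powr ((2 - 2 * p) / p) * B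
            * (dirichlet_form \<pi> K f * sup_norm f powr ((2 - 2 * p) / p))" .
    qed (use B in simp)
    then show "1 / L_const \<pi> K \<eta> p \<le> ereal
                (2 powr (2 / p - 1)
                 * ((\<Sum>x\<in>UNIV. pmf \<pi> x * lam x powr (p / (1 - p)))
                    * (\<Sum>y\<in>UNIV. pmf \<eta> y * \<mu> y powr (p / (1 - p)))) powr ((2 - 2 * p) / p)
                 * (\<Sum>e\<in>{e \<in> edges. Q \<pi> K e \<noteq> 0}. 1 / Q \<pi> K e
                      * (\<Sum>(x, y)\<in>pairs_through \<gamma> e. pmf \<pi> x * pmf \<eta> y / (lam x * \<mu> y))\<^sup>2))"
      by (simp add: M_def B_def w_def)
  next
    define w where "w = (\<lambda>(x, y). pmf \<pi> x * pmf \<eta> y)"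
    define B where "B = (\<Sum>e\<in>{e \<in> edges. Q \<pi> K e \<noteq> 0}. 1 / Q \<pi> K e * (\<Sum>z\<in>pairs_through \<gamma> e. w z)\<^sup>2)"
    have w: "0 \<le> w z" for z
      by (auto simp: w_def split: prod.split)
    have B: "0 \<le> B"
      using S by (simp add: B_def)
    have "1 / L_const \<pi> K \<eta> 1 \<le> ereal (2 * B)"
    proof (rule inverse_L_const_le)
      fix f assume f: "mean \<pi> f = 0" "0 < mean \<eta> (\<lambda>x. \<bar>f x\<bar>)"
      \<comment> \<open>For \<open>p = 1\<close> the exponent of the norm is 0; since
        \<open>0 powr 0 = 0\<close>, the factor equals 1 only for a nonzero norm.\<close>
      have "sup_norm f \<noteq> 0"
      proof
        assume "sup_norm f = 0"
        then have "f x = 0" for x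
          using abs_le_sup_norm[of f x] by simp
        then show False
          using f by (simp add: mean_def)
      qed
      moreover have "(mean \<eta> (\<lambda>x. \<bar>f x\<bar>))\<^sup>2 \<le> (\<Sum>(x, y)\<in>UNIV. w (x, y) * \<bar>f x - f y\<bar>)\<^sup>2"
        using f mean_abs_le_sum_diff[OF f(1)] by (intro power_mono) (auto simp: w_def)
      moreover have "\<dots> \<le> 2 * dirichlet_form \<pi> K f * B"
        unfolding B_def by (rule sum_diff_path_bound[OF K assms(7) w])
      ultimately show "mean \<eta> (\<lambda>x. \<bar>f x\<bar>) powr (2 / 1)
          \<le> 2 * B * (dirichlet_form \<pi> K f * sup_norm f powr ((2 - 2 * 1) / 1))"
        using f by (simp add: mult_ac)
    qed (use B in simp)
    then show "1 / L_const \<pi> K \<eta> 1 \<le> ereal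
                (2 * (\<Sum>e\<in>{e \<in> edges. Q \<pi> K e \<noteq> 0}. 1 / Q \<pi> K e
                       * (\<Sum>(x, y)\<in>pairs_through \<gamma> e. pmf \<pi> x * pmf \<eta> y)\<^sup>2))"
      by (simp add: B_def w_def)
  qed
qed

end
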